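(* Let $\Sigma$ be a finite alphabet and let $d_G$ be either the Besicovitch pseudometric $d_B$ or the Weyl pseudometric $d_W$ on $\Sigma^{\mathbb{Z}}$. If $f:\Sigma^{\mathbb{Z}}\to\Sigma^{\mathbb{Z}}$ is a cellular automaton that is contracting, i.e. $d_G(f(x),f(y))\le d_G(x,y)$ for all $x,y\in\Sigma^{\mathbb{Z}}$, then $f$ has a neighborhood of size $1$: there are $n\in\mathbb{Z}$ and a map $g:\Sigma\to\Sigma$ such that $f(x)_i=g(x_{i+n})$ for all $x\in\Sigma^{\mathbb{Z}}$, $i\in\mathbb{Z}$.
   Context: For words $u,v$ of equal length, $H(u,v)$ is the Hamming distance. On $\Sigma^{\mathbb{Z}}$, $d_B(x,y)=\limsup_{n\to\infty}\frac{H(x_{[-n,n]},y_{[-n,n]})}{2n+1}$ and $d_W(x,y)=\limsup_{n\to\infty}\max_{m\in\mathbb{Z}}\frac{H(x_{[m-n,m+n]},y_{[m-n,m+n]})}{2n+1}$. A cellular automaton on $\Sigma^{\mathbb{Z}}$ is a map that is continuous in the product topology and commutes with the shift $\sigma(x)_i=x_{i+1}$; equivalently, it is given by a finite neighborhood and a local rule. *)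

theory Defs
  imports "HOL-Analysis.Analysis"
begin

type_synonym 'a config = "int \<Rightarrow> 'a"

(* Only meaningful for words of equal length. *)
definition hamming :: "'a list \<Rightarrow> 'a list \<Rightarrow> nat" where
  "hamming u v = card {i. i < length u \<and> u ! i \<noteq> v ! i}"

definition subword :: "'a config \<Rightarrow> int \<Rightarrow> int \<Rightarrow> 'a list" where
  "subword x a b = map x [a..b]"

definition besicovitch_dist :: "'a config \<Rightarrow> 'a config \<Rightarrow> ereal" where
  "besicovitch_dist x y =
     limsup (\<lambda>n. ereal (real (hamming (subword x (- int n) (int n)) (subword y (- int n) (int n)))
                        / real (2 * n + 1)))"

(* The maximum over all integers m exists: see finite_range_hamming below. *)
definition weyl_dist :: "'a config \<Rightarrow> 'a config \<Rightarrow> ereal" where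
  "weyl_dist x y =
     limsup (\<lambda>n. ereal (MAX m. real (hamming (subword x (m - int n) (m + int n))
                                             (subword y (m - int n) (m + int n)))
                               / real (2 * n + 1)))"

lemma hamming_le_length: "hamming u v \<le> length u"
proof -
  have "card {i. i < length u \<and> u ! i \<noteq> v ! i} \<le> card {..<length u}"
    by (rule card_mono) auto
  then show ?thesis by (simp add: hamming_def)
qed

lemma finite_range_hamming:
  "finite (range (\<lambda>m. real (hamming (subword x (m - int n) (m + int n))
                                    (subword y (m - int n) (m + int n))) / real (2 * n + 1)))"
proof -
  have "hamming (subword x (m - int n) (m + int n)) (subword y (m - int n) (m + int n)) \<le> 2 * n + 1"
    for m
    using hamming_le_length[of "subword x (m - int n) (m + int n)"
        "subword y (m - int n) (m + int n)"]
    by (simp add: subword_def)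
  then have "range (\<lambda>m. real (hamming (subword x (m - int n) (m + int n))
                                    (subword y (m - int n) (m + int n))) / real (2 * n + 1))
     \<subseteq> (\<lambda>k. real k / real (2 * n + 1)) ` {..2 * n + 1}"
    by blast
  then show ?thesis by (rule finite_subset) simp
qed

definition shift :: "'a config \<Rightarrow> 'a config" where
  "shift x = (\<lambda>i. x (i + 1))"

definition config_topology :: "'a config topology" where
  "config_topology = product_topology (\<lambda>_. discrete_topology UNIV) UNIV"

definition cellular_automaton :: "('a config \<Rightarrow> 'a config) \<Rightarrow> bool" where
  "cellular_automaton f \<longleftrightarrow>
     continuous_map config_topology config_topology f \<and> (\<forall>x. f (shift x) = shift (f x))"

definition contracting ::
  "('a config \<Rightarrow> 'a config \<Rightarrow> ereal) \<Rightarrow> ('a config \<Rightarrow> 'a config) \<Rightarrow> bool" where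
  "contracting d f \<longleftrightarrow> (\<forall>x y. d (f x) (f y) \<le> d x y)"

end

(* Two configurations that differ in one cell can be repeated with a long period P, which puts them
   at distance 1/P; so a contracting automaton changes at most one output cell when one input cell
   changes. If the set E of essential neighbours had a least element l and a greatest element
   h \<noteq> l, take a left context in which a change at h matters and a right context in which a change
   at l matters, and glue them around a single cell. The symbol e in that cell then determines two
   distinct output cells, with non-constant values \<phi> e and \<psi> e, and no change of e affects both.
   This is impossible: symbols separated by \<psi> have equal \<phi>, and a symbol with another \<phi> value
   would have the \<psi> values of both. *)

theory Submission
  imports Defs
begin

section \<open>Counting differences and members of residue classes in a window\<close>

lemma hamming_subword:
  "hamming (subword x a b) (subword y a b) = card {i \<in> {a..b}. x i \<noteq> y i}"
proof -
  have "{i \<in> {a..b}. x i \<noteq> y i} =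
      (\<lambda>k. a + int k) ` {k. k < length (subword x a b) \<and> subword x a b ! k \<noteq> subword y a b ! k}"
    (is "?L = _ ` ?R")
  proof (intro subset_antisym subsetI)
    fix i assume "i \<in> ?L"
    then show "i \<in> (\<lambda>k. a + int k) ` ?R"
      by (intro image_eqI[where x = "nat (i - a)"]) (auto simp: subword_def nth_upto)
  qed (auto simp: subword_def nth_upto)
  moreover have "inj_on (\<lambda>k. a + int k) ?R" by (auto simp: inj_on_def)
  ultimately show ?thesis by (simp add: hamming_def card_image)
qed

text \<open>The window centred at \<open>0\<close> is one of those in the maximum. This treats both
  choices of \<open>d\<close> at once: upper bounds are shown for the Weyl distance, lower bounds
  for the Besicovitch distance.\<close>

lemma besicovitch_le_weyl: "besicovitch_dist x y \<le> weyl_dist x y"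
  unfolding besicovitch_dist_def weyl_dist_def
proof (intro Limsup_mono always_eventually allI)
  fix n
  show "ereal (real (hamming (subword x (- int n) (int n)) (subword y (- int n) (int n)))
           / real (2 * n + 1))
      \<le> ereal (MAX m. real (hamming (subword x (m - int n) (m + int n))
                (subword y (m - int n) (m + int n))) / real (2 * n + 1))"
    using Max_ge[OF finite_range_hamming[of x n y] rangeI[of _ 0]] by simp
qed

text \<open>The error stays bounded for every interval, so it vanishes on division by the window
  length and leaves the density \<open>1 / P\<close>.\<close>

lemma card_residue_class:
  fixes P a b p :: int
  assumes "P > 0" "b - a + 1 = int N"
  shows "\<bar>real (card {i \<in> {a..b}. P dvd i - p}) - real N / real_of_int P\<bar> \<le> 1"
proof -
  \<comment> \<open>\<open>u\<close> is the largest \<open>k\<close> with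
    \<open>p + k * P \<le> b\<close>, and \<open>- v\<close> the smallest with
    \<open>a \<le> p + k * P\<close>.\<close>
  define u v where "u = (b - p) div P" and "v = (p - a) div P"
  have u: "u * P \<le> b - p" "b - p < u * P + P"
    using assms(1) pos_mod_bound[of P "b - p"] pos_mod_sign[of P "b - p"]
      div_mult_mod_eq[of "b - p" P] unfolding u_def by linarith+
  have v: "v * P \<le> p - a" "p - a < v * P + P"
    using assms(1) pos_mod_bound[of P "p - a"] pos_mod_sign[of P "p - a"]
      div_mult_mod_eq[of "p - a" P] unfolding v_def by linarith+
  have mem: "k \<in> {- v..u} \<longleftrightarrow> p + k * P \<in> {a..b}" for k
  proof -
    have le_iff: "m \<le> w \<longleftrightarrow> m * P \<le> c" if "w * P \<le> c" "c < w * P + P" for m w c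
    proof
      assume "m \<le> w"
      then have "m * P \<le> w * P" using assms(1) by simp
      with that show "m * P \<le> c" by linarith
    next
      assume "m * P \<le> c"
      with that have "m * P < (w + 1) * P" unfolding distrib_right by linarith
      then show "m \<le> w" using assms(1) by simp
    qed
    show ?thesis using le_iff[OF u, of k] le_iff[OF v, of "- k"] by auto
  qed
  have "{i \<in> {a..b}. P dvd i - p} = (\<lambda>k. p + k * P) ` {- v..u}"
  proof (intro subset_antisym subsetI)
    fix i assume i: "i \<in> {i \<in> {a..b}. P dvd i - p}"
    then obtain k where "i - p = P * k" by (auto elim: dvdE)
    then have k: "i = p + k * P" by (simp add: algebra_simps)
    with i have "k \<in> {- v..u}" unfolding mem by simp
    with k show "i \<in> (\<lambda>k. p + k * P) ` {- v..u}" by (rule image_eqI)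
  next
    fix i assume "i \<in> (\<lambda>k. p + k * P) ` {- v..u}"
    then obtain k where "i = p + k * P" "k \<in> {- v..u}" by (rule imageE)
    then show "i \<in> {i \<in> {a..b}. P dvd i - p}" unfolding mem by simp
  qed
  moreover have "inj_on (\<lambda>k. p + k * P) {- v..u}"
    using assms(1) by (intro inj_onI) simp
  ultimately have card: "card {i \<in> {a..b}. P dvd i - p} = nat (u + v + 1)"
    by (simp add: card_image)
  have prod: "(u + v + 1) * P = u * P + v * P + P" by (simp add: distrib_right)
  \<comment> \<open>Ensures that \<open>nat (u + v + 1)\<close> does not truncate, even for
    \<open>N = 0\<close>.\<close>
  have "(- 1) * P < (u + v + 1) * P" using u v assms unfolding prod by linarith
  then have "- 1 < u + v + 1" using assms(1) by (simp only: mult_less_cancel_right_pos)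
  then have "real (nat (u + v + 1)) - real N / P
      = real_of_int ((u + v + 1) * P - int N) / P"
    using assms(1) by (simp add: field_simps)
  moreover have "\<bar>(u + v + 1) * P - int N\<bar> \<le> P" using u v assms(2) unfolding prod by linarith
  then have "\<bar>real_of_int ((u + v + 1) * P - int N)\<bar> \<le> P" by linarith
  ultimately show ?thesis using assms(1) unfolding card by (simp only: abs_divide) simp
qed

section \<open>Distance bounds from residue classes\<close>

lemma tendsto_add_divide_odd:
  "(\<lambda>n. a + c / real (2 * n + 1)) \<longlonglongrightarrow> a"
proof -
  have "(\<lambda>n. c / real (2 * n + 1)) \<longlonglongrightarrow> 0"
    by (intro tendsto_divide_0[OF tendsto_const] filterlim_at_top_imp_at_infinity
        filterlim_compose[OF filterlim_real_sequentially] filterlim_subseq)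
      (auto simp: strict_mono_def)
  from tendsto_add[OF tendsto_const this] show ?thesis by simp
qed

text \<open>Wherever it is centred, a window of length \<open>2 * n + 1\<close> meets the class of
  \<open>p\<close> in at most \<open>(2 * n + 1) / P + 1\<close> cells, so the bound survives the
  maximum over \<open>m\<close>.\<close>

lemma weyl_dist_sparse:
  fixes P :: int
  assumes "P > 0" and diff: "\<And>i. x i \<noteq> y i \<Longrightarrow> P dvd i - p"
  shows "weyl_dist x y \<le> ereal (1 / real_of_int P)"
proof -
  have "real (hamming (subword x (m - int n) (m + int n)) (subword y (m - int n) (m + int n)))
      / real (2 * n + 1) \<le> 1 / P + 1 / real (2 * n + 1)" for m n
  proof -
    have "card {i \<in> {m - int n..m + int n}. x i \<noteq> y i}
        \<le> card {i \<in> {m - int n..m + int n}. P dvd i - p}"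
      using diff by (intro card_mono finite_subset[OF _ finite_atLeastAtMost_int]) auto
    moreover have "real (card {i \<in> {m - int n..m + int n}. P dvd i - p})
        \<le> real (2 * n + 1) / P + 1"
      using card_residue_class[OF assms(1), of "m + int n" "m - int n" "2 * n + 1" p] by linarith
    ultimately have "real (card {i \<in> {m - int n..m + int n}. x i \<noteq> y i}) / real (2 * n + 1)
        \<le> (real (2 * n + 1) / P + 1) / real (2 * n + 1)"
      by (intro divide_right_mono) auto
    also have "\<dots> = 1 / P + 1 / real (2 * n + 1)"
      by (simp only: add_divide_distrib) simp
    finally show ?thesis by (simp add: hamming_subword)
  qed
  then have "(MAX m. real (hamming (subword x (m - int n) (m + int n))
      (subword y (m - int n) (m + int n))) / real (2 * n + 1)) \<le> 1 / P + 1 / real (2 * n + 1)" for n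
    by (intro Max.boundedI finite_range_hamming) blast+
  then have "weyl_dist x y \<le> limsup (\<lambda>n. ereal (1 / P + 1 / real (2 * n + 1)))"
    unfolding weyl_dist_def by (intro Limsup_mono always_eventually) simp
  also have "\<dots> = ereal (1 / P)"
    by (rule lim_imp_Limsup[OF trivial_limit_sequentially tendsto_ereal[OF tendsto_add_divide_odd]])
  finally show ?thesis .
qed

text \<open>The classes of \<open>p\<close> and \<open>q\<close> are disjoint and each has density
  \<open>1 / P\<close>, so the densities add up.\<close>

lemma besicovitch_dist_two_classes:
  fixes P :: int
  assumes "P > 0" and "\<not> P dvd p - q"
    and diff: "\<And>i. P dvd i - p \<Longrightarrow> x i \<noteq> y i" "\<And>i. P dvd i - q \<Longrightarrow> x i \<noteq> y i"
  shows "ereal (2 / real_of_int P) \<le> besicovitch_dist x y"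
proof -
  have "2 / P + (- 2) / real (2 * n + 1)
      \<le> real (hamming (subword x (- int n) (int n)) (subword y (- int n) (int n)))
          / real (2 * n + 1)" for n
  proof -
    let ?A = "\<lambda>p. {i \<in> {- int n..int n}. P dvd i - p}"
    have "i \<in> ?A p \<Longrightarrow> i \<notin> ?A q" for i
      using assms(2) dvd_diff[of P "i - q" "i - p"] by auto
    then have "card (?A p) + card (?A q) = card (?A p \<union> ?A q)"
      by (intro card_Un_disjoint[symmetric] finite_subset[OF _ finite_atLeastAtMost_int]) auto
    also have "\<dots> \<le> card {i \<in> {- int n..int n}. x i \<noteq> y i}"
      using diff by (intro card_mono finite_subset[OF _ finite_atLeastAtMost_int]) auto
    finally have "real (card (?A p)) + real (card (?A q))
        \<le> real (card {i \<in> {- int n..int n}. x i \<noteq> y i})" by linarith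
    moreover have "real (card (?A s)) \<ge> real (2 * n + 1) / P - 1" for s
      using card_residue_class[OF assms(1), of "int n" "- int n" "2 * n + 1" s] by linarith
    note this[of p] this[of q]
    ultimately have "(real (2 * n + 1) / P - 1) + (real (2 * n + 1) / P - 1)
        \<le> real (card {i \<in> {- int n..int n}. x i \<noteq> y i})"
      by (meson add_mono order_trans)
    then have "2 * (real (2 * n + 1) / P - 1)
        \<le> real (card {i \<in> {- int n..int n}. x i \<noteq> y i})"
      by (simp only: mult_2)
    then have "2 * (real (2 * n + 1) / P - 1) / real (2 * n + 1)
        \<le> real (card {i \<in> {- int n..int n}. x i \<noteq> y i}) / real (2 * n + 1)"
      by (intro divide_right_mono) auto
    moreover have "2 * (w / P - 1) / w = 2 / P + (- 2) / w" if "w > 0" for w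
      using that assms(1) by (simp add: field_simps)
    from this[of "real (2 * n + 1)"] have "2 * (real (2 * n + 1) / P - 1) / real (2 * n + 1)
        = 2 / P + (- 2) / real (2 * n + 1)"
      by simp
    ultimately show ?thesis by (simp add: hamming_subword)
  qed
  then have "limsup (\<lambda>n. ereal (2 / P + (- 2) / real (2 * n + 1))) \<le> besicovitch_dist x y"
    unfolding besicovitch_dist_def by (intro Limsup_mono always_eventually) simp
  moreover have "limsup (\<lambda>n. ereal (2 / P + (- 2) / real (2 * n + 1))) = ereal (2 / P)"
    by (rule lim_imp_Limsup[OF trivial_limit_sequentially tendsto_ereal[OF tendsto_add_divide_odd]])
  ultimately show ?thesis by simp
qed

section \<open>Translations and locality of cellular automata\<close>

lemma cellular_automaton_translate:
  assumes "cellular_automaton f"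
  shows "f (\<lambda>i. x (i + k)) j = f x (j + k)"
proof -
  have s: "f (shift x) = shift (f x)" for x
    using assms by (simp add: cellular_automaton_def)
  have pos: "f (\<lambda>i. x (i + int n)) = (\<lambda>j. f x (j + int n))" for x n
  proof (induction n)
    case (Suc n)
    have "f (\<lambda>i. x (i + int (Suc n))) = f (shift (\<lambda>i. x (i + int n)))"
      by (simp add: shift_def algebra_simps)
    also have "\<dots> = (\<lambda>j. f x (j + int (Suc n)))"
      unfolding s Suc by (simp add: shift_def algebra_simps)
    finally show ?case .
  qed simp
  show ?thesis
  proof (cases "k \<ge> 0")
    case True
    with pos[of x "nat k"] show ?thesis by simp
  next
    case False
    \<comment> \<open>Translating by \<open>k\<close> and then by \<open>- k\<close> restores
      \<open>x\<close>, so the nonnegative case applies to the translated configuration.\<close>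
    with pos[of "\<lambda>i. x (i + k)" "nat (- k)"] show ?thesis
      by (simp add: fun_eq_iff)
  qed
qed

text \<open>The Curtis-Hedlund-Lyndon argument: by continuity each \<open>x\<close> lies in a
  cylinder on which the output at \<open>0\<close> is constant. The space is compact because the
  alphabet is finite, so finitely many cylinders cover it; \<open>J\<close> collects the coordinates
  that they restrict.\<close>

lemma cellular_automaton_local:
  fixes f :: "(int \<Rightarrow> 'a::finite) \<Rightarrow> (int \<Rightarrow> 'a)"
  assumes "cellular_automaton f"
  shows "\<exists>J. finite J \<and> (\<forall>x y. (\<forall>i\<in>J. x i = y i) \<longrightarrow> f x 0 = f y 0)"
proof -
  let ?T = "config_topology :: (int \<Rightarrow> 'a) topology"
  have top: "topspace ?T = UNIV"
    by (simp add: config_topology_def)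
  have "\<exists>U. finite {i. U i \<noteq> UNIV} \<and> x \<in> Pi\<^sub>E UNIV U \<and> (\<forall>y \<in> Pi\<^sub>E UNIV U. f y 0 = f x 0)" for x
  proof -
    have "continuous_map ?T (discrete_topology UNIV) (\<lambda>x. f x 0)"
      using assms unfolding cellular_automaton_def config_topology_def
      by (auto simp: continuous_map_componentwise_UNIV)
    then have "openin ?T {y \<in> topspace ?T. f y 0 \<in> {f x 0}}"
      by (rule openin_continuous_map_preimage) simp
    then have "openin ?T {y. f y 0 = f x 0}" by (simp add: top)
    then show ?thesis
      unfolding config_topology_def openin_product_topology_alt by fastforce
  qed
  then obtain U where U: "\<And>x. finite {i. U x i \<noteq> UNIV}" "\<And>x. x \<in> Pi\<^sub>E UNIV (U x)"
    "\<And>x y. y \<in> Pi\<^sub>E UNIV (U x) \<Longrightarrow> f y 0 = f x 0"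
    by metis
  have "\<exists>F. finite F \<and> F \<subseteq> range (\<lambda>x. Pi\<^sub>E UNIV (U x)) \<and> topspace ?T \<subseteq> \<Union>F"
  proof (rule compactinD)
    show "compactin ?T (topspace ?T)"
      by (simp add: config_topology_def compact_space_product_topology
          compact_space_discrete_topology flip: compact_space_def del: topspace_product_topology)
    show "openin ?T C" if "C \<in> range (\<lambda>x. Pi\<^sub>E UNIV (U x))" for C
      using that U(1) by (auto simp: config_topology_def openin_PiE_gen)
    show "topspace ?T \<subseteq> \<Union>(range (\<lambda>x. Pi\<^sub>E UNIV (U x)))"
      using U(2) by blast
  qed
  then obtain F where F: "finite F" "F \<subseteq> range (\<lambda>x. Pi\<^sub>E UNIV (U x))" "topspace ?T \<subseteq> \<Union>F"
    by blast
  then obtain X where X: "finite X" "F = (\<lambda>x. Pi\<^sub>E UNIV (U x)) ` X"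
    by (metis finite_subset_image)
  show ?thesis
  proof (intro exI conjI allI impI)
    show "finite (\<Union>x\<in>X. {i. U x i \<noteq> UNIV})" using X U by simp
    fix y z :: "int \<Rightarrow> 'a" assume eq: "\<forall>i \<in> (\<Union>x\<in>X. {i. U x i \<noteq> UNIV}). y i = z i"
    have "y \<in> \<Union>F" using F(3) unfolding top by blast
    then obtain x where x: "x \<in> X" "y \<in> Pi\<^sub>E UNIV (U x)" unfolding X(2) by (rule UN_E)
    have "z i \<in> U x i" for i
    proof (cases "U x i = UNIV")
      case False
      with x(1) have "i \<in> (\<Union>x\<in>X. {i. U x i \<noteq> UNIV})" by auto
      then have "y i = z i" by (rule bspec[OF eq])
      with PiE_mem[OF x(2), of i] show ?thesis by simp
    qed simp
    then have "z \<in> Pi\<^sub>E UNIV (U x)" by (simp add: PiE_iff)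
    with U(3) x(2) show "f y 0 = f z 0" by metis
  qed
qed

section \<open>Periodic repetition of a single change\<close>

text \<open>If both output cells changed, repetition with period \<open>P\<close> would give outputs
  at distance at least \<open>2 / P\<close> from inputs at distance at most
  \<open>1 / P\<close>.\<close>

lemma contracting_single_change:
  fixes f :: "(int \<Rightarrow> 'a::finite) \<Rightarrow> (int \<Rightarrow> 'a)"
  assumes d: "d = besicovitch_dist \<or> d = weyl_dist"
    and ca: "cellular_automaton f" and con: "contracting d f"
    and xy: "\<And>i. i \<noteq> 0 \<Longrightarrow> x i = y i" and "p \<noteq> q"
  shows "f x p = f y p \<or> f x q = f y q"
proof (rule ccontr)
  assume neg: "\<not> ?thesis"
  obtain J where J: "finite J" "\<And>x y. (\<And>i. i \<in> J \<Longrightarrow> x i = y i) \<Longrightarrow> f x 0 = f y 0"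
    using cellular_automaton_local[OF ca] by meson
  obtain r where r: "r \<ge> 0" "\<And>j. j \<in> J \<Longrightarrow> \<bar>j\<bar> \<le> r"
  proof
    show "Max (insert 0 (abs ` J)) \<ge> 0" "\<And>j. j \<in> J \<Longrightarrow> \<bar>j\<bar> \<le> Max (insert 0 (abs ` J))"
      using J(1) by auto
  qed
  \<comment> \<open>The block from \<open>- R\<close> to \<open>R\<close>, of length
    \<open>P\<close>, contains the cells read by \<open>p\<close> and by \<open>q\<close>.
    \<open>per x\<close> repeats this block of \<open>x\<close>; \<open>(i + R) mod P - R\<close> is
    the representative of \<open>i\<close> in it. Also \<open>P > \<bar>p - q\<bar>\<close>, so
    \<open>p\<close> and \<open>q\<close> lie in different classes.\<close>
  define R where "R = r + \<bar>p\<bar> + \<bar>q\<bar>"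
  define P where "P = 2 * R + 1"
  define per :: "(int \<Rightarrow> 'a) \<Rightarrow> (int \<Rightarrow> 'a)" where "per x = (\<lambda>i. x ((i + R) mod P - R))" for x
  have P: "P > 0" using r by (simp add: P_def R_def)
  \<comment> \<open>The bound on \<open>s\<close>, met by \<open>p\<close> and \<open>q\<close>,
    keeps all cells read by \<open>s\<close> inside the block, where \<open>x\<close> and
    \<open>per x\<close> agree.\<close>
  have f_per: "f (per x) i = f x s" if "P dvd i - s" "\<bar>s\<bar> \<le> \<bar>p\<bar> + \<bar>q\<bar>" for x i s
  proof -
    have "f (\<lambda>j. per x (j + i)) 0 = f (\<lambda>j. x (j + s)) 0"
    proof (rule J(2))
      fix j assume "j \<in> J"
      then have "\<bar>j\<bar> \<le> r" by (rule r)
      then have "0 \<le> j + s + R" "j + s + R < P" using that by (auto simp: P_def R_def)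
      moreover have "(j + i + R) mod P = (j + s + R) mod P"
        using that(1) by (simp add: mod_eq_dvd_iff)
      ultimately have "(j + i + R) mod P = j + s + R" by simp
      then show "per x (j + i) = x (j + s)" by (simp add: per_def)
    qed
    then show ?thesis by (simp add: cellular_automaton_translate[OF ca])
  qed
  have "weyl_dist (per x) (per y) \<le> ereal (1 / P)"
  proof (rule weyl_dist_sparse[OF P])
    fix i assume "per x i \<noteq> per y i"
    then have "(i + R) mod P = R" using xy[of "(i + R) mod P - R"] by (auto simp: per_def)
    then have "(i + R) mod P = R mod P" using r by (simp add: P_def R_def)
    then show "P dvd i - 0" by (simp add: mod_eq_dvd_iff)
  qed
  moreover have "ereal (2 / P) \<le> besicovitch_dist (f (per x)) (f (per y))"
  proof (rule besicovitch_dist_two_classes[OF P])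
    show "\<not> P dvd p - q"
    proof
      assume "P dvd p - q"
      with \<open>p \<noteq> q\<close> have "P \<le> \<bar>p - q\<bar>" using dvd_imp_le_int[of "p - q" P] P by simp
      then show False using r by (simp add: P_def R_def)
    qed
  qed (use neg f_per in auto)
  \<comment> \<open>Contraction is applied before passing to the Weyl distance if \<open>d\<close>
    is Besicovitch, and after it if \<open>d\<close> is Weyl.\<close>
  moreover have "besicovitch_dist (f (per x)) (f (per y)) \<le> weyl_dist (per x) (per y)"
    using d con besicovitch_le_weyl order_trans unfolding contracting_def by blast
  ultimately have "ereal (2 / P) \<le> ereal (1 / P)" by (meson order_trans)
  then show False using P by (simp add: divide_le_cancel)
qed

section \<open>Essential neighbours\<close>

text \<open>Turn \<open>x\<close> into \<open>y\<close> on \<open>J\<close> one cell at a time: a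
  cell in \<open>E\<close> already has the right symbol, and a cell outside \<open>E\<close> does
  not affect \<open>F\<close>.\<close>

lemma eq_if_agree_on_essential:
  fixes F :: "('i \<Rightarrow> 'a) \<Rightarrow> 'b"
  assumes "finite J" and J: "\<And>x y. (\<And>i. i \<in> J \<Longrightarrow> x i = y i) \<Longrightarrow> F x = F y"
    and E: "\<And>i x s. i \<notin> E \<Longrightarrow> F (x(i := s)) = F x"
    and agree: "\<And>i. i \<in> E \<Longrightarrow> x i = y i"
  shows "F x = F y"
proof -
  have "F (\<lambda>i. if i \<in> D then y i else x i) = F x" if "finite D" for D
    using that
  proof induction
    case (insert j D)
    have "(\<lambda>i. if i \<in> insert j D then y i else x i) = (\<lambda>i. if i \<in> D then y i else x i)(j := y j)"
      by auto
    moreover have "F ((\<lambda>i. if i \<in> D then y i else x i)(j := y j)) = F (\<lambda>i. if i \<in> D then y i else x i)"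
    proof (cases "j \<in> E")
      case True
      with agree insert.hyps show ?thesis by (intro arg_cong[where f = F]) auto
    qed (rule E)
    ultimately show ?case using insert.IH by simp
  qed simp
  from this[OF assms(1)] J[of "\<lambda>i. if i \<in> J then y i else x i" y] show ?thesis by simp
qed

theorem proposition2:
  fixes f :: "(int \<Rightarrow> 'a::finite) \<Rightarrow> (int \<Rightarrow> 'a)"
    and d :: "(int \<Rightarrow> 'a) \<Rightarrow> (int \<Rightarrow> 'a) \<Rightarrow> ereal"
  assumes "d = besicovitch_dist \<or> d = weyl_dist"
    and "cellular_automaton f"
    and "contracting d f"
  shows "\<exists>(n::int) (g :: 'a \<Rightarrow> 'a). \<forall>x i. f x i = g (x (i + n))"
proof -
  note translate = cellular_automaton_translate[OF assms(2)]
  obtain J where J: "finite J" "\<And>x y. (\<And>i. i \<in> J \<Longrightarrow> x i = y i) \<Longrightarrow> f x 0 = f y 0"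
    using cellular_automaton_local[OF assms(2)] by meson
  \<comment> \<open>Unlike a cell of \<open>J\<close>, each cell of \<open>E\<close> comes with a
    context in which changing it matters; the argument needs this at both extremes.\<close>
  define E where "E = {j. \<exists>x s. f (x(j := s)) 0 \<noteq> f x 0}"
  have "E \<subseteq> J"
  proof
    fix j assume "j \<in> E"
    then obtain x s where "f (x(j := s)) 0 \<noteq> f x 0" by (auto simp: E_def)
    with J(2)[of "x(j := s)" x] show "j \<in> J" by (metis fun_upd_other)
  qed
  then have "finite E" using J(1) finite_subset by blast
  have agree: "f x 0 = f y 0" if "\<And>i. i \<in> E \<Longrightarrow> x i = y i" for x y
    by (rule eq_if_agree_on_essential[where F = "\<lambda>x. f x 0" and E = E, OF J _ that])
      (auto simp: E_def)
  have one: "l = h" if lh: "l \<in> E" "h \<in> E" "\<And>j. j \<in> E \<Longrightarrow> l \<le> j \<and> j \<le> h" for l h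
  proof (rule ccontr)
    assume "l \<noteq> h"
    obtain x a where x: "f (x(l := a)) 0 \<noteq> f x 0" using lh(1) by (auto simp: E_def)
    obtain z c where z: "f (z(h := c)) 0 \<noteq> f z 0" using lh(2) by (auto simp: E_def)
    define \<phi> where "\<phi> e = f (x(l := e)) 0" for e
    define \<psi> where "\<psi> e = f (z(h := e)) 0" for e
    \<comment> \<open>Cell \<open>l\<close> of \<open>x\<close> and cell \<open>h\<close> of
      \<open>z\<close> are both moved to \<open>0\<close>, with \<open>x\<close> kept on the right
      and \<open>z\<close> on the left.\<close>
    define u where "u e i = (if i = 0 then e else if i > 0 then x (i + l) else z (i + h))" for e i
    \<comment> \<open>As \<open>l\<close> is least in \<open>E\<close>, cell \<open>- l\<close>
      reads only cells from \<open>0\<close> on, where it sees \<open>x(l := e)\<close>.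
      Symmetrically, cell \<open>- h\<close> sees \<open>z(h := e)\<close>.\<close>
    have "f (u e) (- l) = \<phi> e" for e
    proof -
      have "f (\<lambda>i. u e (i + - l)) 0 = \<phi> e"
        unfolding \<phi>_def by (rule agree) (use lh(3) in \<open>force simp: u_def\<close>)
      then show ?thesis by (simp only: translate) simp
    qed
    moreover have "f (u e) (- h) = \<psi> e" for e
    proof -
      have "f (\<lambda>i. u e (i + - h)) 0 = \<psi> e"
        unfolding \<psi>_def by (rule agree) (use lh(3) in \<open>force simp: u_def\<close>)
      then show ?thesis by (simp only: translate) simp
    qed
    moreover have "f (u e) (- l) = f (u e') (- l) \<or> f (u e) (- h) = f (u e') (- h)" for e e'
      by (rule contracting_single_change[OF assms]) (use \<open>l \<noteq> h\<close> in \<open>auto simp: u_def\<close>)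
    ultimately have "\<phi> e = \<phi> e' \<or> \<psi> e = \<psi> e'" for e e' by simp
    moreover have "\<phi> a \<noteq> \<phi> (x l)" "\<psi> c \<noteq> \<psi> (z h)"
      using x z by (simp_all add: \<phi>_def \<psi>_def)
    \<comment> \<open>\<open>c\<close> and \<open>z h\<close> differ under \<open>\<psi>\<close>, so
      they agree under \<open>\<phi>\<close>. One of \<open>a\<close> and \<open>x l\<close> has
      another value under \<open>\<phi>\<close>, and its value under \<open>\<psi>\<close> would
      have to equal both \<open>\<psi> c\<close> and \<open>\<psi> (z h)\<close>.\<close>
    ultimately show False by metis
  qed
  \<comment> \<open>If \<open>E\<close> is empty, the output is constant and any \<open>n\<close>
    serves.\<close>
  obtain n where n: "E \<subseteq> {n}"
  proof (cases "E = {}")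
    case False
    with \<open>finite E\<close> have "Min E = Max E" by (intro one) auto
    with \<open>finite E\<close> have "E \<subseteq> {Min E}"
      by (metis Max_ge Min_le antisym singleton_iff subsetI)
    then show thesis by (rule that)
  qed (use that in simp)
  \<comment> \<open>Only cell \<open>n\<close> can matter, so constant configurations already
    determine the local rule.\<close>
  have "f x i = f (\<lambda>_. x (i + n)) 0" for x i
  proof -
    have "f x i = f (\<lambda>j. x (j + i)) 0" by (simp add: translate)
    also have "\<dots> = f (\<lambda>_. x (i + n)) 0"
      by (rule agree) (use n in \<open>auto simp: add.commute\<close>)
    finally show ?thesis .
  qed
  then show ?thesis by (intro exI[of _ n] exI[of _ "\<lambda>s. f (\<lambda>_. s) 0"]) simp
qed

end
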